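(* Let $n$ be even and let $$|\Psi\rangle=\sum_{\vec s}\Psi(\vec s)\,|\vec s\rangle\in\mathbb C^{2^n},\qquad \Psi(\vec s)=\mathcal N^{-1/2}\,\sigma(\vec w^T\vec s+b),$$ with $w_i=1$ for all $i=1,\ldots,n$, $b=0$, and $\sigma(x)=\delta_{x,0}$ (that is, $\sigma(0)=1$ and $\sigma(x)=0$ for $x\neq 0$). The function $\sigma:\mathbb R\to\mathbb C$ does not need to be discontinuous; it only needs to agree with $\delta_{x,0}$ on the integers. Then $|\Psi\rangle$ has logarithmic entanglement scaling. In particular, its von Neumann entanglement entropy on any subset $A\subset\{1,\ldots,n\}$ satisfies $$S_A=\tfrac12\log|A|+O(1).$$
   Context: The state is a state of $n$ qubits. $\vec s=(s_1,\ldots,s_n)$ with $s_i=\pm1$, the vectors $|\vec s\rangle$ are the $Z$-basis product states (the standard orthonormal product basis of $(\mathbb C^2)^{\otimes n}$), and $\mathcal N^{-1/2}$ is the normalization making $|\Psi\rangle$ a unit vector. For a subset $A$ of the $n$ spins with complement $\bar A$, $S_A=-\mathrm{Tr}(\rho_A\log\rho_A)$ is the von Neumann entropy of the reduced density matrix $\rho_A=\mathrm{Tr}_{\bar A}|\Psi\rangle\langle\Psi|$. Asymptotic notation is with respect to scaling in $n$, for the family of states labelled by $n$. The state $|\Psi\rangle$ is called the Dicke state.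
   Formalization: "Any subset A" fails for A={1,…,n} (S_A=0) and log|A| is undefined for A empty; the formula is proved uniformly for nonempty A with |A| ≤ (1−δ)n for each δ>0, and with min(|A|,n−|A|) in place of |A| for all nonempty proper A; scaling refers to |A| ≤ n/2. *)

theory Defs
  imports Complex_Main "HOL-Library.FuncSet"
begin

text \<open>
  Qubits are labelled by natural numbers. The Hilbert space of the qubits in a finite set \<open>V\<close> is
  the space of complex functions on the product basis \<open>spins V\<close>, and operators on it are given by
  their matrix elements in that basis. Only values on \<open>spins V\<close> are meaningful.
\<close>

definition spins :: "nat set \<Rightarrow> (nat \<Rightarrow> int) set" where
  "spins V = V \<rightarrow>\<^sub>E {-1, 1}"

type_synonym state = "(nat \<Rightarrow> int) \<Rightarrow> complex"

type_synonym 'i cmatrix = "'i \<Rightarrow> 'i \<Rightarrow> complex"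

definition mmul :: "'i set \<Rightarrow> 'i cmatrix \<Rightarrow> 'i cmatrix \<Rightarrow> 'i cmatrix" where
  "mmul I M N = (\<lambda>i k. \<Sum>j\<in>I. M i j * N j k)"

definition madjoint :: "'i cmatrix \<Rightarrow> 'i cmatrix" where
  "madjoint M = (\<lambda>i j. cnj (M j i))"

definition mtrace :: "'i set \<Rightarrow> 'i cmatrix \<Rightarrow> complex" where
  "mtrace I M = (\<Sum>i\<in>I. M i i)"

definition mdiag :: "('i \<Rightarrow> real) \<Rightarrow> 'i cmatrix" where
  "mdiag d = (\<lambda>i j. if i = j then complex_of_real (d i) else 0)"

definition meq :: "'i set \<Rightarrow> 'i cmatrix \<Rightarrow> 'i cmatrix \<Rightarrow> bool" where
  "meq I M N \<longleftrightarrow> (\<forall>i\<in>I. \<forall>j\<in>I. M i j = N i j)"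

definition munitary :: "'i set \<Rightarrow> 'i cmatrix \<Rightarrow> bool" where
  "munitary I U \<longleftrightarrow>
     meq I (mmul I U (madjoint U)) (mdiag (\<lambda>_. 1)) \<and>
     meq I (mmul I (madjoint U) U) (mdiag (\<lambda>_. 1))"

text \<open>
  Functional calculus for a Hermitian matrix: if \<open>M = U diag(d) U\<^sup>*\<close> with \<open>U\<close> unitary and \<open>d\<close> real,
  then \<open>f(M) = U diag(f \<circ> d) U\<^sup>*\<close>, which does not depend on the diagonalization chosen. Entries
  outside \<open>I \<times> I\<close> are set to 0, so that the result is unique as a function.
\<close>

definition mfun :: "'i set \<Rightarrow> (real \<Rightarrow> real) \<Rightarrow> 'i cmatrix \<Rightarrow> 'i cmatrix" where
  "mfun I f M = (THE F. \<exists>U d. munitary I U \<and>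
      meq I M (mmul I (mmul I U (mdiag d)) (madjoint U)) \<and>
      F = (\<lambda>i j. if i \<in> I \<and> j \<in> I
                 then mmul I (mmul I U (mdiag (f \<circ> d))) (madjoint U) i j else 0))"

definition pure_density :: "state \<Rightarrow> (nat \<Rightarrow> int) cmatrix" where
  "pure_density \<psi> = (\<lambda>s s'. \<psi> s * cnj (\<psi> s'))"

text \<open>
  Partial trace over \<open>V - A\<close> of an operator on the qubits in \<open>V\<close>; \<open>override_on t s A\<close> is the
  configuration that equals \<open>s\<close> on \<open>A\<close> and \<open>t\<close> elsewhere.
\<close>

definition partial_trace ::
    "nat set \<Rightarrow> nat set \<Rightarrow> (nat \<Rightarrow> int) cmatrix \<Rightarrow> (nat \<Rightarrow> int) cmatrix" where
  "partial_trace V A R =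
     (\<lambda>s s'. \<Sum>t\<in>spins (V - A). R (override_on t s A) (override_on t s' A))"

text \<open>
  The library convention \<open>ln 0 = 0\<close> yields the usual \<open>0 log 0 = 0\<close> on the kernel of \<open>\<rho>\<close>.
  The trace is real, so taking its real part only changes the type.
\<close>

definition von_neumann_entropy :: "'i set \<Rightarrow> 'i cmatrix \<Rightarrow> real" where
  "von_neumann_entropy I \<rho> = - Re (mtrace I (mmul I \<rho> (mfun I ln \<rho>)))"

definition entanglement_entropy :: "nat \<Rightarrow> state \<Rightarrow> nat set \<Rightarrow> real" where
  "entanglement_entropy n \<psi> A =
     von_neumann_entropy (spins A) (partial_trace {1..n} A (pure_density \<psi>))"

definition perceptron_amplitude ::
    "nat \<Rightarrow> (nat \<Rightarrow> real) \<Rightarrow> real \<Rightarrow> (real \<Rightarrow> complex) \<Rightarrow> state" where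
  "perceptron_amplitude n w b \<sigma> = (\<lambda>s. \<sigma> ((\<Sum>i=1..n. w i * real_of_int (s i)) + b))"

definition perceptron_state ::
    "nat \<Rightarrow> (nat \<Rightarrow> real) \<Rightarrow> real \<Rightarrow> (real \<Rightarrow> complex) \<Rightarrow> state" where
  "perceptron_state n w b \<sigma> = (\<lambda>s.
     perceptron_amplitude n w b \<sigma> s /
     complex_of_real (sqrt (\<Sum>s'\<in>spins {1..n}. (cmod (perceptron_amplitude n w b \<sigma> s'))\<^sup>2)))"

definition kronecker_on_ints :: "(real \<Rightarrow> complex) \<Rightarrow> bool" where
  "kronecker_on_ints \<sigma> \<longleftrightarrow> (\<forall>k::int. \<sigma> (real_of_int k) = (if k = 0 then 1 else 0))"

lemma kronecker_on_ints_delta: "kronecker_on_ints (\<lambda>x. if x = 0 then 1 else 0)"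
  by (simp add: kronecker_on_ints_def)

lemma kronecker_on_ints_continuous:
  "\<exists>\<sigma>. continuous_on UNIV \<sigma> \<and> kronecker_on_ints \<sigma>"
proof (intro exI conjI)
  show "continuous_on UNIV (\<lambda>x. complex_of_real (max 0 (1 - \<bar>x\<bar>)))"
    by (intro continuous_intros)
  have "max 0 (1 - \<bar>real_of_int k\<bar>) = 0" if "k \<noteq> 0" for k :: int
    using that by linarith
  then show "kronecker_on_ints (\<lambda>x. complex_of_real (max 0 (1 - \<bar>x\<bar>)))"
    by (simp add: kronecker_on_ints_def)
qed

text \<open>
  Logarithmic entanglement scaling of a family of \<open>n\<close>-qubit states, with \<open>n\<close> in \<open>N\<close>: the entropy of
  a subsystem is of order \<open>log |A|\<close>, uniformly in \<open>n\<close> and \<open>A\<close>. As the entropies of a subsystem and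
  of its complement agree for pure states, scaling with \<open>|A|\<close> refers to the smaller part.
\<close>

definition log_entanglement_scaling :: "nat set \<Rightarrow> (nat \<Rightarrow> state) \<Rightarrow> bool" where
  "log_entanglement_scaling N \<Psi> \<longleftrightarrow>
     (\<exists>c>0. \<exists>C>0. \<exists>k. \<forall>n\<in>N. \<forall>A\<subseteq>{1..n}. k \<le> card A \<and> 2 * card A \<le> n \<longrightarrow>
        c * ln (real (card A)) \<le> entanglement_entropy n (\<Psi> n) A \<and>
        entanglement_entropy n (\<Psi> n) A \<le> C * ln (real (card A)))"

end

theory Submission
  imports Defs
begin

text \<open>
  The reduced density matrix is block diagonal with respect to the number of up spins in \<open>A\<close>, and
  constant on each block. Its nonzero eigenvalues are therefore the hypergeometric probabilities
  \<open>p k = C(a, k) C(b, m - k) / C(2 m, m)\<close> with \<open>a = |A|\<close>, \<open>b = n - a\<close> and \<open>n = 2 m\<close>, whose Shannon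
  entropy is to be estimated; one may assume \<open>a \<le> b\<close>. It is bounded below by \<open>- ln (max p)\<close>, and
  \<open>max p\<close> is of order \<open>1 / sqrt a\<close>. It is bounded above by the cross entropy with respect to
  weights \<open>exp (- |2 k - a| / sqrt a)\<close>, since these sum to a multiple of \<open>sqrt a\<close> and the second
  moment of \<open>2 k - a\<close> is at most \<open>a\<close>.
\<close>

subsection \<open>Entropy of diagonalizable matrices\<close>

lemma diagonal_conjugation_entry:
  assumes "finite I" "i \<in> I" "j \<in> I"
  shows "mmul I (mmul I U (mdiag d)) (madjoint U) i j
    = (\<Sum>k\<in>I. U i k * complex_of_real (d k) * cnj (U j k))"
  using assms by (simp add: mmul_def mdiag_def madjoint_def if_distrib sum.delta cong: if_cong)

lemma munitary_rows:
  assumes "finite I" "munitary I U" "i \<in> I" "j \<in> I"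
  shows "(\<Sum>k\<in>I. U i k * cnj (U j k)) = of_bool (i = j)"
  using assms by (auto simp: munitary_def meq_def mmul_def mdiag_def madjoint_def)

lemma munitary_columns:
  assumes "finite I" "munitary I U" "i \<in> I" "j \<in> I"
  shows "(\<Sum>k\<in>I. cnj (U k i) * U k j) = of_bool (i = j)"
  using assms by (auto simp: munitary_def meq_def mmul_def mdiag_def madjoint_def)

lemma sum_of_bool_eq_left:
  fixes f :: "'i \<Rightarrow> 'b :: semiring_1"
  assumes "finite I" "k \<in> I"
  shows "(\<Sum>l\<in>I. f l * of_bool (l = k)) = f k"
proof -
  have "(\<Sum>l\<in>I. f l * of_bool (l = k)) = (\<Sum>l\<in>I. if l = k then f l else 0)"
    by (intro sum.cong) auto
  then show ?thesis using assms by simp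
qed

text \<open>Column \<open>k\<close> of \<open>U\<close> is an eigenvector of \<open>M\<close> with
  eigenvalue \<open>d k\<close>: orthonormality of the columns collapses the sum over
  \<open>l\<close>.\<close>

lemma diagonalization_times_unitary:
  assumes fin: "finite I" and U: "munitary I U"
    and M: "\<And>i j. i \<in> I \<Longrightarrow> j \<in> I \<Longrightarrow>
      M i j = (\<Sum>k\<in>I. U i k * complex_of_real (d k) * cnj (U j k))"
    and "i \<in> I" "k \<in> I"
  shows "(\<Sum>j\<in>I. M i j * U j k) = U i k * complex_of_real (d k)"
proof -
  have "(\<Sum>j\<in>I. M i j * U j k)
      = (\<Sum>j\<in>I. \<Sum>l\<in>I. U i l * complex_of_real (d l) * (cnj (U j l) * U j k))"
    using assms by (simp add: sum_distrib_left sum_distrib_right mult_ac)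
  also have "\<dots> = (\<Sum>l\<in>I. U i l * complex_of_real (d l) * (\<Sum>j\<in>I. cnj (U j l) * U j k))"
    by (subst sum.swap) (simp add: sum_distrib_left)
  also have "\<dots> = (\<Sum>l\<in>I. U i l * complex_of_real (d l) * of_bool (l = k))"
    using munitary_columns[OF fin U _ \<open>k \<in> I\<close>] by (intro sum.cong) auto
  also have "\<dots> = U i k * complex_of_real (d k)"
    using fin \<open>k \<in> I\<close> by (rule sum_of_bool_eq_left)
  finally show ?thesis .
qed

text \<open>
  The matrix \<open>W = V\<^sup>* U\<close> satisfies \<open>W diag(d) = diag(e) W\<close>, hence \<open>W l k\<close> vanishes unless
  \<open>d k = e l\<close>, and so \<open>W\<close> also intertwines \<open>diag(f \<circ> d)\<close> and \<open>diag(f \<circ> e)\<close>.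
\<close>

lemma functional_calculus_unique:
  assumes fin: "finite I" and U: "munitary I U" and V: "munitary I V"
    and MU: "\<And>i j. i \<in> I \<Longrightarrow> j \<in> I \<Longrightarrow>
      M i j = (\<Sum>k\<in>I. U i k * complex_of_real (d k) * cnj (U j k))"
    and MV: "\<And>i j. i \<in> I \<Longrightarrow> j \<in> I \<Longrightarrow>
      M i j = (\<Sum>k\<in>I. V i k * complex_of_real (e k) * cnj (V j k))"
    and i: "i \<in> I" and j: "j \<in> I"
  shows "(\<Sum>k\<in>I. U i k * complex_of_real (f (d k)) * cnj (U j k))
    = (\<Sum>k\<in>I. V i k * complex_of_real (f (e k)) * cnj (V j k))"
proof -
  define W where "W l k = (\<Sum>i\<in>I. cnj (V i l) * U i k)" for l k
  have herm: "M i j = cnj (M j i)" if "i \<in> I" "j \<in> I" for i j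
    using that by (simp add: MU mult_ac)
  have inter: "W l k * complex_of_real (d k) = complex_of_real (e l) * W l k"
    if k: "k \<in> I" and l: "l \<in> I" for k l
  proof -
    have "W l k * complex_of_real (d k) = (\<Sum>i\<in>I. cnj (V i l) * (\<Sum>j\<in>I. M i j * U j k))"
      using diagonalization_times_unitary[OF fin U MU _ k]
      by (simp add: W_def sum_distrib_left sum_distrib_right mult_ac)
    also have "\<dots> = (\<Sum>j\<in>I. (\<Sum>i\<in>I. cnj (V i l) * M i j) * U j k)"
      by (subst sum_distrib_left, subst sum.swap) (simp add: sum_distrib_left sum_distrib_right mult_ac)
    also have "\<dots> = (\<Sum>j\<in>I. complex_of_real (e l) * cnj (V j l) * U j k)"
    proof (intro sum.cong refl)
      fix j assume j: "j \<in> I"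
      have "(\<Sum>i\<in>I. cnj (V i l) * M i j) = cnj (\<Sum>i\<in>I. M j i * V i l)"
        using j herm[OF _ j] by (simp add: mult.commute)
      also have "\<dots> = complex_of_real (e l) * cnj (V j l)"
        using diagonalization_times_unitary[OF fin V MV j l] by (simp add: mult.commute)
      finally show "(\<Sum>i\<in>I. cnj (V i l) * M i j) * U j k
        = complex_of_real (e l) * cnj (V j l) * U j k" by simp
    qed
    finally show ?thesis by (simp add: W_def sum_distrib_left mult_ac)
  qed
  have interf: "W l k * complex_of_real (f (d k)) = complex_of_real (f (e l)) * W l k"
    if "k \<in> I" "l \<in> I" for k l
    using inter[OF that] by (cases "W l k = 0") auto
  have Uexp: "U i k = (\<Sum>l\<in>I. V i l * W l k)" for k
  proof -
    have "(\<Sum>l\<in>I. V i l * W l k) = (\<Sum>j\<in>I. (\<Sum>l\<in>I. V i l * cnj (V j l)) * U j k)"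
      unfolding W_def sum_distrib_left sum_distrib_right
      by (subst sum.swap) (simp add: mult_ac)
    also have "\<dots> = (\<Sum>j\<in>I. U j k * of_bool (j = i))"
      using munitary_rows[OF fin V i] by (intro sum.cong) auto
    also have "\<dots> = U i k"
      using fin i by (rule sum_of_bool_eq_left)
    finally show ?thesis ..
  qed
  have Vexp: "cnj (V j l) = (\<Sum>k\<in>I. W l k * cnj (U j k))" for l
  proof -
    have "(\<Sum>k\<in>I. W l k * cnj (U j k))
        = (\<Sum>i\<in>I. cnj (V i l) * (\<Sum>k\<in>I. U i k * cnj (U j k)))"
      unfolding W_def sum_distrib_left sum_distrib_right
      by (subst sum.swap) (simp add: mult_ac)
    also have "\<dots> = (\<Sum>i\<in>I. cnj (V i l) * of_bool (i = j))"
      using munitary_rows[OF fin U _ j] by (intro sum.cong) auto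
    also have "\<dots> = cnj (V j l)"
      using fin j by (rule sum_of_bool_eq_left)
    finally show ?thesis ..
  qed
  \<comment> \<open>After inserting \<open>U = V W\<close>, the function \<open>f\<close> is moved
    across \<open>W\<close> by \<open>interf\<close>, and \<open>W\<close> times the adjoint of
    \<open>U\<close> recombines to the adjoint of \<open>V\<close>.\<close>
  have "(\<Sum>k\<in>I. U i k * complex_of_real (f (d k)) * cnj (U j k))
      = (\<Sum>k\<in>I. \<Sum>l\<in>I. V i l * (W l k * complex_of_real (f (d k))) * cnj (U j k))"
    by (subst Uexp) (simp add: sum_distrib_left sum_distrib_right mult_ac)
  also have "\<dots> = (\<Sum>k\<in>I. \<Sum>l\<in>I. V i l * (complex_of_real (f (e l)) * W l k) * cnj (U j k))"
    by (intro sum.cong refl) (simp add: interf)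
  also have "\<dots> = (\<Sum>l\<in>I. V i l * complex_of_real (f (e l)) * cnj (V j l))"
    by (subst sum.swap, subst Vexp) (simp add: sum_distrib_left mult_ac)
  finally show ?thesis .
qed

text \<open>The description operator in \<open>mfun\<close> is resolved here: the given
  diagonalization is a witness, and by \<open>functional_calculus_unique\<close> every other one
  yields the same matrix. The zero entries outside \<open>I\<close> turn agreement on
  \<open>I\<close> into equality of functions.\<close>

lemma mfun_diagonalization:
  assumes fin: "finite I" and U: "munitary I U"
    and M: "\<And>i j. i \<in> I \<Longrightarrow> j \<in> I \<Longrightarrow>
      M i j = (\<Sum>k\<in>I. U i k * complex_of_real (d k) * cnj (U j k))"
    and ij: "i \<in> I" "j \<in> I"
  shows "mfun I f M i j = (\<Sum>k\<in>I. U i k * complex_of_real (f (d k)) * cnj (U j k))"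
proof -
  let ?F = "\<lambda>U d i j. if i \<in> I \<and> j \<in> I
    then mmul I (mmul I U (mdiag (f \<circ> d))) (madjoint U) i j else 0"
  have "mfun I f M = ?F U d"
    unfolding mfun_def
  proof (rule the_equality)
    show "\<exists>U' d'. munitary I U' \<and>
        meq I M (mmul I (mmul I U' (mdiag d')) (madjoint U')) \<and> ?F U d = ?F U' d'"
      using U M fin by (intro exI[of _ U] exI[of _ d])
        (auto simp: meq_def diagonal_conjugation_entry)
  next
    fix F
    assume "\<exists>U' d'. munitary I U' \<and>
        meq I M (mmul I (mmul I U' (mdiag d')) (madjoint U')) \<and> F = ?F U' d'"
    then obtain V e where V: "munitary I V"
      and MV: "meq I M (mmul I (mmul I V (mdiag e)) (madjoint V))" and F: "F = ?F V e"
      by blast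
    have MV': "M i j = (\<Sum>k\<in>I. V i k * complex_of_real (e k) * cnj (V j k))"
      if "i \<in> I" "j \<in> I" for i j
      using MV that fin by (simp add: meq_def diagonal_conjugation_entry)
    show "F = ?F U d"
      unfolding F
      using functional_calculus_unique[OF fin V U MV' M]
      by (intro ext) (auto simp: diagonal_conjugation_entry[OF fin])
  qed
  then show ?thesis
    using ij by (simp add: diagonal_conjugation_entry[OF fin])
qed

text \<open>Cyclicity of the trace in coordinates: the sum over \<open>j\<close> replaces
  \<open>M U\<close> by \<open>U\<close> times the diagonal matrix of \<open>d\<close>, and the sum
  over \<open>i\<close> is then the squared norm of a column of \<open>U\<close>, which is
  1.\<close>

lemma von_neumann_entropy_diagonalization:
  assumes fin: "finite I" and U: "munitary I U"
    and M: "\<And>i j. i \<in> I \<Longrightarrow> j \<in> I \<Longrightarrow>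
      M i j = (\<Sum>k\<in>I. U i k * complex_of_real (d k) * cnj (U j k))"
  shows "von_neumann_entropy I M = - (\<Sum>k\<in>I. d k * ln (d k))"
proof -
  have "mtrace I (mmul I M (mfun I ln M))
      = (\<Sum>i\<in>I. \<Sum>j\<in>I. \<Sum>k\<in>I. M i j * U j k * (complex_of_real (ln (d k)) * cnj (U i k)))"
    unfolding mtrace_def mmul_def
    by (intro sum.cong refl)
      (simp add: mfun_diagonalization[OF fin U M] sum_distrib_left mult_ac)
  also have "\<dots> = (\<Sum>i\<in>I. \<Sum>k\<in>I. (\<Sum>j\<in>I. M i j * U j k) *
      (complex_of_real (ln (d k)) * cnj (U i k)))"
    by (rule sum.cong[OF refl], subst sum.swap) (simp add: sum_distrib_right)
  also have "\<dots> = (\<Sum>i\<in>I. \<Sum>k\<in>I. complex_of_real (d k * ln (d k)) * (cnj (U i k) * U i k))"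
    using diagonalization_times_unitary[OF fin U M]
    by (intro sum.cong refl) (simp add: mult_ac)
  also have "\<dots> = (\<Sum>k\<in>I. complex_of_real (d k * ln (d k)) * (\<Sum>i\<in>I. cnj (U i k) * U i k))"
    by (subst sum.swap) (simp add: sum_distrib_left)
  also have "\<dots> = complex_of_real (\<Sum>k\<in>I. d k * ln (d k))"
    by (simp add: munitary_columns[OF fin U])
  finally show ?thesis
    by (simp add: von_neumann_entropy_def)
qed

text \<open>
  On each level set of \<open>\<kappa>\<close> the Householder reflection \<open>1 - c v v\<^sup>T\<close> with \<open>v = e\<^sub>r - x\<close> exchanges a
  basis vector \<open>e\<^sub>r\<close> with the normalized constant vector \<open>x\<close>. For a level set with one element
  \<open>v = 0\<close> and \<open>c = 1 / 0 = 0\<close>.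
\<close>

lemma von_neumann_entropy_block_constant:
  fixes \<kappa> :: "'i \<Rightarrow> 'k" and g :: "'k \<Rightarrow> real"
  assumes fin: "finite I"
    and M: "\<And>i j. i \<in> I \<Longrightarrow> j \<in> I \<Longrightarrow>
      M i j = (if \<kappa> i = \<kappa> j then complex_of_real (g (\<kappa> i)) else 0)"
  defines "p \<equiv> \<lambda>k. real (card {i \<in> I. \<kappa> i = k}) * g k"
  shows "von_neumann_entropy I M = - (\<Sum>k\<in>\<kappa> ` I. p k * ln (p k))"
proof -
  define N where "N k = real (card {i \<in> I. \<kappa> i = k})" for k
  define r where "r k = (SOME i. i \<in> I \<and> \<kappa> i = k)" for k
  define x where "x k = 1 / sqrt (N k)" for k
  define c where "c k = 1 / (1 - x k)" for k
  define v where "v i = of_bool (i = r (\<kappa> i)) - x (\<kappa> i)" for i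
  define h :: "'i \<Rightarrow> 'i \<Rightarrow> real" where
    "h i j = (if \<kappa> i = \<kappa> j then of_bool (i = j) - c (\<kappa> i) * v i * v j else 0)" for i j
  \<comment> \<open>A constant block has rank at most one, so its only possibly nonzero eigenvalue
    is placed at the representative of the level set.\<close>
  define d where "d l = (if l = r (\<kappa> l) then p (\<kappa> l) else 0)" for l
  have r: "r (\<kappa> i) \<in> I" "\<kappa> (r (\<kappa> i)) = \<kappa> i" if "i \<in> I" for i
    using someI[of "\<lambda>j. j \<in> I \<and> \<kappa> j = \<kappa> i" i] that by (auto simp: r_def)
  have N1: "N (\<kappa> i) \<ge> 1" if "i \<in> I" for i
  proof -
    have "card {j \<in> I. \<kappa> j = \<kappa> i} > 0"
      using that fin by (auto simp: card_gt_0_iff)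
    then show ?thesis by (simp add: N_def)
  qed
  have x1: "x (\<kappa> i) = 1 \<longleftrightarrow> N (\<kappa> i) = 1" if "i \<in> I" for i
    using N1[OF that] by (auto simp: x_def)
  have xx: "N (\<kappa> i) * (x (\<kappa> i) * x (\<kappa> i)) = 1" if "i \<in> I" for i
    using N1[OF that] by (simp add: x_def)
  \<comment> \<open>The basis vector at \<open>r\<close> and the normalized constant vector are unit
    vectors with inner product \<open>x\<close>, so their difference has squared norm
    \<open>2 * (1 - x)\<close>. Hence \<open>c\<close> is 2 divided by this squared norm, as in
    every Householder reflection.\<close>
  have sumv: "(\<Sum>l | l \<in> I \<and> \<kappa> l = \<kappa> i. v l * v l) = 2 * (1 - x (\<kappa> i))" if i: "i \<in> I" for i
  proof -
    let ?K = "{l \<in> I. \<kappa> l = \<kappa> i}"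
    have "(\<Sum>l\<in>?K. v l * v l)
        = (\<Sum>l\<in>?K. (1 - 2 * x (\<kappa> i)) * of_bool (l = r (\<kappa> i)) + x (\<kappa> i) * x (\<kappa> i))"
      by (intro sum.cong refl) (auto simp: v_def algebra_simps)
    also have "\<dots> = (1 - 2 * x (\<kappa> i)) + N (\<kappa> i) * (x (\<kappa> i) * x (\<kappa> i))"
      using fin r[OF i] sum_of_bool_eq_left[of ?K "r (\<kappa> i)" "\<lambda>_. 1 - 2 * x (\<kappa> i)"]
      by (simp add: sum.distrib N_def)
    finally show ?thesis using xx[OF i] by simp
  qed
  have hh: "(\<Sum>l\<in>I. h i l * h j l) = of_bool (i = j)" if i: "i \<in> I" and j: "j \<in> I" for i j
  proof (cases "\<kappa> i = \<kappa> j")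
    case True
    let ?K = "{l \<in> I. \<kappa> l = \<kappa> i}"
    have K: "finite ?K" "i \<in> ?K" "j \<in> ?K" using fin i j True by auto
    have "(\<Sum>l\<in>I. h i l * h j l) = (\<Sum>l\<in>?K. h i l * h j l)"
      using fin by (intro sum.mono_neutral_right) (auto simp: h_def)
    also have "\<dots> = (\<Sum>l\<in>?K. of_bool (i = j) * of_bool (l = i)
        + (- c (\<kappa> i) * v j * v l) * of_bool (l = i)
        + (- c (\<kappa> i) * v i * v l) * of_bool (l = j)
        + c (\<kappa> i) * c (\<kappa> i) * v i * v j * (v l * v l))"
      using True by (intro sum.cong refl) (auto simp: h_def algebra_simps)
    also have "\<dots> = of_bool (i = j) - 2 * (c (\<kappa> i) * v i * v j)
        + c (\<kappa> i) * c (\<kappa> i) * v i * v j * (2 * (1 - x (\<kappa> i)))"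
      unfolding sum.distrib sum_of_bool_eq_left[OF K(1,2)] sum_of_bool_eq_left[OF K(1,3)]
      unfolding sum_distrib_left[symmetric] sumv[OF i]
      by (simp add: algebra_simps)
    also have "\<dots> = of_bool (i = j) + 2 * (c (\<kappa> i) * (c (\<kappa> i) * (1 - x (\<kappa> i))) - c (\<kappa> i)) * v i * v j"
      by (simp add: algebra_simps)
    also have "c (\<kappa> i) * (c (\<kappa> i) * (1 - x (\<kappa> i))) = c (\<kappa> i)"
      by (cases "x (\<kappa> i) = 1") (simp_all add: c_def)
    finally show ?thesis by simp
  next
    case False
    then have "(\<Sum>l\<in>I. h i l * h j l) = 0" by (intro sum.neutral) (auto simp: h_def)
    then show ?thesis using False by auto
  qed
  \<comment> \<open>The column of the reflection at the representative is the normalized constant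
    vector. On a one-element level set the reflection is the identity and
    \<open>x = 1\<close>.\<close>
  have hr: "h i (r (\<kappa> i)) = x (\<kappa> i)" if i: "i \<in> I" for i
  proof (cases "N (\<kappa> i) = 1")
    case True
    obtain a where "{j \<in> I. \<kappa> j = \<kappa> i} = {a}"
      using True by (auto simp: N_def card_1_singleton_iff)
    moreover have "i \<in> {j \<in> I. \<kappa> j = \<kappa> i}" "r (\<kappa> i) \<in> {j \<in> I. \<kappa> j = \<kappa> i}"
      using r[OF i] i by auto
    ultimately have "r (\<kappa> i) = i" by (metis singletonD)
    then show ?thesis using True by (simp add: h_def v_def x_def)
  next
    case False
    then have "c (\<kappa> i) * (1 - x (\<kappa> i)) = 1" using x1[OF i] by (simp add: c_def)
    moreover have "v (r (\<kappa> i)) = 1 - x (\<kappa> i)" using r[OF i] by (simp add: v_def)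
    ultimately have "c (\<kappa> i) * v i * v (r (\<kappa> i)) = v i"
      by (metis mult.commute mult.left_neutral mult.assoc)
    moreover have "h i (r (\<kappa> i)) = of_bool (i = r (\<kappa> i)) - c (\<kappa> i) * v i * v (r (\<kappa> i))"
      using r[OF i] by (simp add: h_def)
    ultimately have "h i (r (\<kappa> i)) = of_bool (i = r (\<kappa> i)) - v i"
      by (simp only:)
    then show ?thesis by (simp add: v_def)
  qed
  have sym: "h i j = h j i" for i j by (auto simp: h_def)
  have eqM: "(\<Sum>l\<in>I. h i l * d l * h j l) = (if \<kappa> i = \<kappa> j then g (\<kappa> i) else 0)"
    if i: "i \<in> I" and j: "j \<in> I" for i j
  proof (cases "\<kappa> i = \<kappa> j")
    case True
    have "(\<Sum>l\<in>I. h i l * d l * h j l)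
        = (\<Sum>l\<in>I. x (\<kappa> i) * p (\<kappa> i) * x (\<kappa> i) * of_bool (l = r (\<kappa> i)))"
    proof (intro sum.cong refl)
      fix l
      show "h i l * d l * h j l = x (\<kappa> i) * p (\<kappa> i) * x (\<kappa> i) * of_bool (l = r (\<kappa> i))"
      proof (cases "l = r (\<kappa> i)")
        case True
        then have "h i l = x (\<kappa> i)" "h j l = x (\<kappa> i)"
          using hr[OF i] hr[OF j] \<open>\<kappa> i = \<kappa> j\<close> by simp_all
        moreover have "d l = p (\<kappa> i)" using True r(2)[OF i] by (simp add: d_def)
        ultimately show ?thesis using True by simp
      next
        case False
        then have "h i l * d l = 0" by (auto simp: h_def d_def)
        then show ?thesis using False by auto
      qed
    qed
    also have "\<dots> = x (\<kappa> i) * p (\<kappa> i) * x (\<kappa> i)"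
      by (rule sum_of_bool_eq_left[OF fin r(1)[OF i]])
    also have "\<dots> = (N (\<kappa> i) * (x (\<kappa> i) * x (\<kappa> i))) * g (\<kappa> i)"
      by (simp add: p_def N_def)
    finally show ?thesis using xx[OF i] True by simp
  next
    case False
    then have "(\<Sum>l\<in>I. h i l * d l * h j l) = 0" by (intro sum.neutral) (auto simp: h_def)
    then show ?thesis using False by simp
  qed
  define U where "U i j = complex_of_real (h i j)" for i j
  have "munitary I U"
    using hh fin sym
    by (auto simp: munitary_def meq_def mmul_def madjoint_def mdiag_def U_def
      simp flip: of_real_mult of_real_sum)
  moreover have "M i j = (\<Sum>k\<in>I. U i k * complex_of_real (d k) * cnj (U j k))"
    if "i \<in> I" "j \<in> I" for i j
    using eqM[OF that] M[OF that]
    by (simp add: U_def flip: of_real_mult of_real_sum)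
  ultimately have "von_neumann_entropy I M = - (\<Sum>l\<in>I. d l * ln (d l))"
    using fin by (intro von_neumann_entropy_diagonalization)
  \<comment> \<open>Away from the representatives \<open>d l = 0\<close>, and these terms vanish
    since \<open>0 * ln 0 = 0\<close>.\<close>
  also have "(\<Sum>l\<in>I. d l * ln (d l)) = (\<Sum>l\<in>r ` \<kappa> ` I. d l * ln (d l))"
    using fin r by (intro sum.mono_neutral_right) (auto simp: d_def)
  also have "\<dots> = (\<Sum>k\<in>\<kappa> ` I. d (r k) * ln (d (r k)))"
    using r by (subst sum.reindex) (auto simp: inj_on_def o_def, metis)
  also have "\<dots> = (\<Sum>k\<in>\<kappa> ` I. p k * ln (p k))"
    using r by (intro sum.cong refl) (auto simp: d_def)
  finally show ?thesis .
qed

subsection \<open>Entropy of the hypergeometric distribution\<close>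

text \<open>Shannon entropy dominates min-entropy: it averages the values \<open>- ln (p k)\<close>,
  each of which is at least \<open>- ln P\<close> where \<open>p k\<close> is positive.\<close>

lemma entropy_ge_of_bounded:
  fixes p :: "'k \<Rightarrow> real"
  assumes "\<And>k. k \<in> K \<Longrightarrow> 0 \<le> p k" "\<And>k. k \<in> K \<Longrightarrow> p k \<le> P" "sum p K = 1"
  shows "- ln P \<le> - (\<Sum>k\<in>K. p k * ln (p k))"
proof -
  have "p k * ln (p k) \<le> p k * ln P" if "k \<in> K" for k
  proof (cases "p k = 0")
    case False
    then have "0 < p k" "p k \<le> P" using assms(1,2)[OF that] by auto
    then show ?thesis by (intro mult_left_mono) auto
  qed simp
  then have "(\<Sum>k\<in>K. p k * ln (p k)) \<le> (\<Sum>k\<in>K. p k * ln P)"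
    by (rule sum_mono)
  also have "\<dots> = ln P" using assms(3) by (simp flip: sum_distrib_right)
  finally show ?thesis by simp
qed

text \<open>Gibbs' inequality for weights that need not be normalized. It follows from
  \<open>ln z \<le> z - 1\<close>, with \<open>z\<close> the ratio of the normalized weight to
  \<open>p k\<close>, averaged over \<open>p\<close>; the right-hand sides then sum to
  \<open>1 - 1\<close>.\<close>

lemma entropy_le_cross_entropy:
  fixes p w :: "'k \<Rightarrow> real"
  assumes "finite K" "\<And>k. k \<in> K \<Longrightarrow> 0 \<le> p k" "\<And>k. k \<in> K \<Longrightarrow> 0 < w k" "sum p K = 1"
  shows "- (\<Sum>k\<in>K. p k * ln (p k)) \<le> ln (sum w K) - (\<Sum>k\<in>K. p k * ln (w k))"
proof -
  have "K \<noteq> {}" using assms(4) by auto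
  then have W: "0 < sum w K" using assms by (intro sum_pos) auto
  have "p k * ln (w k) - p k * ln (p k) - p k * ln (sum w K) \<le> w k / sum w K - p k"
    if k: "k \<in> K" for k
  proof (cases "p k = 0")
    case True
    then show ?thesis using W assms(3)[OF k] by simp
  next
    case False
    then have p: "0 < p k" using assms(2)[OF k] by simp
    define z where "z = w k / sum w K / p k"
    have "ln z \<le> z - 1" using p W assms(3)[OF k] by (intro ln_le_minus_one) (simp add: z_def)
    then have "p k * ln z \<le> p k * (z - 1)" using p by simp
    moreover have "ln z = ln (w k) - ln (sum w K) - ln (p k)"
      using p W assms(3)[OF k] by (simp add: z_def ln_div ln_mult)
    moreover have "p k * (z - 1) = w k / sum w K - p k"
      using p W by (simp add: z_def field_simps)
    ultimately show ?thesis by (simp add: algebra_simps)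
  qed
  then have "(\<Sum>k\<in>K. p k * ln (w k) - p k * ln (p k) - p k * ln (sum w K))
      \<le> (\<Sum>k\<in>K. w k / sum w K - p k)"
    by (rule sum_mono)
  also have "\<dots> = 0"
    using W assms(4) by (simp add: sum_subtractf flip: sum_divide_distrib)
  finally show ?thesis
    using assms(4) by (simp add: sum_subtractf flip: sum_distrib_right)
qed

section \<open>Bounds on binomial coefficients\<close>

lemma central_binomial_Suc:
  "real (Suc m) * real (2 * Suc m choose Suc m) = 2 * real (2 * m + 1) * real (2 * m choose m)"
proof -
  have 1: "Suc m * (2 * Suc m choose Suc m) = 2 * Suc m * (2 * m + 1 choose m)"
    using Suc_times_binomial_eq[of "2 * m + 1" m] by (simp add: mult_ac)
  have 2: "Suc m * (2 * m + 1 choose Suc m) = (2 * m + 1) * (2 * m choose m)"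
    using Suc_times_binomial_eq[of "2 * m" m] by (simp add: mult_ac)
  have 3: "(2 * m + 1 choose Suc m) = (2 * m + 1 choose m)"
    using binomial_symmetric[of m "2 * m + 1"] by simp
  have "Suc m * (2 * Suc m choose Suc m) = 2 * ((2 * m + 1) * (2 * m choose m))"
    using 1 2 3 by (simp del: mult_Suc mult_Suc_right)
  then show ?thesis by (metis of_nat_mult of_nat_numeral mult.assoc)
qed

text \<open>By \<open>central_binomial_Suc\<close>, a step from \<open>m\<close> to
  \<open>m + 1\<close> multiplies the left side by \<open>4 (2 m + 1) (2 m + 3) / (m + 1)^2\<close>,
  which is at most 16 because \<open>(2 m + 1) (2 m + 3) \<le> (2 m + 2)^2\<close>.\<close>

lemma central_binomial_sq_le: "real (2 * m + 1) * (real (2 * m choose m))\<^sup>2 \<le> 16 ^ m"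
proof (induction m)
  case (Suc m)
  let ?c = "real (2 * m choose m)" and ?c' = "real (2 * Suc m choose Suc m)"
  have "(real (Suc m))\<^sup>2 * (real (2 * Suc m + 1) * ?c'\<^sup>2)
      = real (2 * Suc m + 1) * (real (Suc m) * ?c')\<^sup>2"
    by (simp only: power_mult_distrib mult_ac)
  also have "\<dots> = 4 * (real (2 * m + 3) * real (2 * m + 1)) * (real (2 * m + 1) * ?c\<^sup>2)"
    unfolding central_binomial_Suc by (simp add: power2_eq_square algebra_simps)
  also have "\<dots> \<le> 4 * (4 * (real (Suc m))\<^sup>2) * 16 ^ m"
    by (rule mult_mono[OF _ Suc.IH]) (simp_all add: power2_eq_square algebra_simps)
  also have "\<dots> = (real (Suc m))\<^sup>2 * 16 ^ Suc m" by simp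
  finally show ?case by (rule mult_left_le_imp_le) simp
qed simp

text \<open>Here a step multiplies the right side by \<open>4 (2 m + 1)^2 / (m (m + 1))\<close>,
  which is at least 16 because \<open>4 m (m + 1) \<le> (2 m + 1)^2\<close>. Equality holds at
  \<open>m = 1\<close>.\<close>

lemma central_binomial_sq_ge:
  assumes "m > 0"
  shows "16 ^ m \<le> 4 * real m * (real (2 * m choose m))\<^sup>2"
  using assms
proof (induction m rule: nat_induct_non_zero)
  case 1
  show ?case by (simp add: numeral_2_eq_2)
next
  case (Suc m)
  let ?c = "real (2 * m choose m)" and ?c' = "real (2 * Suc m choose Suc m)"
  have "real (Suc m) * 16 ^ Suc m = 16 * real (Suc m) * 16 ^ m" by simp
  also have "\<dots> \<le> 16 * real (Suc m) * (4 * real m * ?c\<^sup>2)"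
    by (rule mult_left_mono[OF Suc.IH]) simp
  also have "\<dots> = (4 * real m * real (Suc m)) * (16 * ?c\<^sup>2)" by simp
  also have "\<dots> \<le> (real (2 * m + 1))\<^sup>2 * (16 * ?c\<^sup>2)"
    by (intro mult_right_mono) (simp_all add: power2_eq_square algebra_simps)
  also have "\<dots> = 4 * (real (Suc m) * ?c')\<^sup>2"
    unfolding central_binomial_Suc by (simp add: power2_eq_square algebra_simps)
  also have "\<dots> = real (Suc m) * (4 * real (Suc m) * ?c'\<^sup>2)"
    by (simp add: power_mult_distrib power2_eq_square)
  finally show ?case by (rule mult_left_le_imp_le) simp
qed

text \<open>It suffices to treat the middle coefficient. For \<open>a = 2 j + 1\<close> this is half
  the central coefficient of \<open>2 j + 2\<close>, so the even case applies at
  \<open>j + 1\<close>.\<close>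

lemma binomial_sq_le: "real (a + 1) * (real (a choose k))\<^sup>2 \<le> 4 ^ a"
proof -
  have le: "(real (a choose k))\<^sup>2 \<le> (real (a choose (a div 2)))\<^sup>2"
    by (simp add: binomial_maximum)
  have "real (a + 1) * (real (a choose k))\<^sup>2 \<le> real (a + 1) * (real (a choose (a div 2)))\<^sup>2"
    by (rule mult_left_mono[OF le]) simp
  also have "\<dots> \<le> 4 ^ a"
  proof (cases "even a")
    case True
    then obtain j where "a = 2 * j" by blast
    then show ?thesis using central_binomial_sq_le[of j] by (simp add: power_mult)
  next
    case False
    then obtain j where a: "a = 2 * j + 1" by (rule oddE)
    have "(2 * Suc j choose Suc j) = 2 * (a choose j)"
      using binomial_symmetric[of j "2 * j + 1"] by (simp add: a)
    then have "real (2 * Suc j + 1) * (2 * real (a choose j))\<^sup>2 \<le> 16 ^ Suc j"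
      using central_binomial_sq_le[of "Suc j"] by simp
    then have "real (2 * Suc j + 1) * (real (a choose j))\<^sup>2 \<le> 4 * 16 ^ j"
      by (simp add: power_mult_distrib mult.commute)
    moreover have "real (a + 1) * (real (a choose j))\<^sup>2 \<le> real (2 * Suc j + 1) * (real (a choose j))\<^sup>2"
      by (intro mult_right_mono) (simp_all add: a)
    moreover have "(4::real) ^ a = 4 * 16 ^ j" by (simp add: a power_mult)
    moreover have "a div 2 = j" using a by simp
    ultimately show ?thesis by simp
  qed
  finally show ?thesis .
qed

section \<open>Hypergeometric weights: moments and maximum\<close>

definition hypergeometric :: "nat \<Rightarrow> nat \<Rightarrow> nat \<Rightarrow> nat \<Rightarrow> real" where
  "hypergeometric a b r k = real (a choose k) * real (b choose (r - k)) / real (a + b choose r)"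

lemma hypergeometric_nonneg: "0 \<le> hypergeometric a b r k"
  by (simp add: hypergeometric_def)

text \<open>Vandermonde's identity. The range has to stop at \<open>r\<close>: for
  \<open>k > r\<close> the truncated difference \<open>r - k\<close> is 0, and the formula gives
  \<open>a choose k\<close> over the denominator instead of 0.\<close>

lemma sum_hypergeometric:
  assumes "r \<le> a + b"
  shows "(\<Sum>k\<le>r. hypergeometric a b r k) = 1"
proof -
  have "(\<Sum>k\<le>r. hypergeometric a b r k)
      = real (\<Sum>k\<le>r. (a choose k) * (b choose (r - k))) / real (a + b choose r)"
    by (simp add: hypergeometric_def sum_divide_distrib)
  then show ?thesis using assms by (simp add: vandermonde)
qed

text \<open>The absorption identity trades a factor \<open>k\<close> for a factor
  \<open>Suc a\<close> while lowering both \<open>a\<close> and \<open>r\<close>. With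
  \<open>f = 1\<close> it yields the first moment, with \<open>f k = k\<close> the second.\<close>

lemma sum_weighted_vandermonde_Suc:
  fixes f :: "nat \<Rightarrow> nat"
  shows "(\<Sum>k\<le>Suc r. k * f k * ((Suc a choose k) * (b choose (Suc r - k))))
    = Suc a * (\<Sum>k\<le>r. f (Suc k) * ((a choose k) * (b choose (r - k))))"
proof -
  have "Suc k * f (Suc k) * ((Suc a choose Suc k) * c) = Suc a * (f (Suc k) * ((a choose k) * c))"
    for k c
    using Suc_times_binomial_eq[of a k] by (metis mult.assoc mult.left_commute)
  then show ?thesis
    unfolding sum.atMost_Suc_shift sum_distrib_left by simp
qed

text \<open>The mean is \<open>a r / (a + b)\<close>; clearing the denominator keeps the identity in
  the natural numbers.\<close>

lemma vandermonde_mean: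
  "(a + b) * (\<Sum>k\<le>r. k * ((a choose k) * (b choose (r - k)))) = a * r * (a + b choose r)"
proof (cases "a = 0 \<or> r = 0")
  case True
  then show ?thesis by (auto intro!: sum.neutral)
next
  case False
  then obtain a' r' where [simp]: "a = Suc a'" "r = Suc r'" by (metis not0_implies_Suc)
  have "(\<Sum>k\<le>r. k * ((a choose k) * (b choose (r - k)))) = a * (a' + b choose r')"
    using sum_weighted_vandermonde_Suc[of "\<lambda>_. 1" a' b r'] by (simp add: vandermonde)
  moreover have "(a + b) * (a' + b choose r') = r * (a + b choose r)"
    using Suc_times_binomial_eq[of "a' + b" r'] by (simp add: mult.commute)
  ultimately show ?thesis by (metis mult.assoc mult.left_commute)
qed

text \<open>The exact value is \<open>a - a (a - 1) / (a + b - 1)\<close>.\<close>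

lemma hypergeometric_second_moment_le:
  assumes ab: "a + b = 2 * m" and "a > 0"
  shows "(\<Sum>k\<le>m. hypergeometric a b m k * (2 * real k - real a)\<^sup>2) \<le> real a"
proof -
  obtain a' m' where a: "a = Suc a'" and m: "m = Suc m'"
    using assms by (metis add_is_0 gr0_implies_Suc mult_0_right not0_implies_Suc not_gr_zero)
  define C where "C = real (a + b choose m)"
  define w where "w k = (a choose k) * (b choose (m - k))" for k
  define M where "M = (\<Sum>k\<le>m. k * w k)"
  define T where "T = (\<Sum>k\<le>m. k * k * w k)"
  define M' where "M' = (\<Sum>k\<le>m'. k * ((a' choose k) * (b choose (m' - k))))"
  have C0: "C > 0" using ab by (simp add: C_def)
  have S: "real (\<Sum>k\<le>m. w k) = C" by (simp add: w_def vandermonde C_def)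
  have M: "2 * real M = real a * C"
  proof -
    have "m * (2 * M) = m * (a * (a + b choose m))"
      using vandermonde_mean[of a b m] ab by (simp add: M_def w_def mult_ac)
    then have "2 * M = a * (a + b choose m)" by (simp add: m del: mult_Suc)
    then show ?thesis unfolding C_def by (metis of_nat_mult of_nat_numeral)
  qed
  have ab': "a' + b = 2 * m' + 1" using ab a m by simp
  \<comment> \<open>Pascal's rule splits the central coefficient of \<open>2 m' + 2\<close> into two
    equal terms.\<close>
  have D: "2 * real (2 * m' + 1 choose m') = C"
    using ab binomial_symmetric[of m' "2 * m' + 1"] by (simp add: C_def m)
  have T: "T = a * (M' + (2 * m' + 1 choose m'))"
  proof -
    have "T = a * (\<Sum>k\<le>m'. Suc k * ((a' choose k) * (b choose (m' - k))))"
      using sum_weighted_vandermonde_Suc[of "\<lambda>k. k" a' b m'] by (simp add: T_def w_def a m)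
    also have "(\<Sum>k\<le>m'. Suc k * ((a' choose k) * (b choose (m' - k)))) = M' + (a' + b choose m')"
      by (simp add: M'_def sum.distrib vandermonde)
    finally show ?thesis by (simp add: ab')
  qed
  have "(2 * m' + 1) * M' = a' * m' * (2 * m' + 1 choose m')"
    using vandermonde_mean[of a' b m'] by (simp add: M'_def ab')
  \<comment> \<open>Bounding \<open>m' / (2 m' + 1)\<close> by 1/2 is the only loss against the
    exact second moment.\<close>
  then have "2 * ((2 * m' + 1) * M') \<le> (2 * m' + 1) * (a' * (2 * m' + 1 choose m'))"
    by (simp add: algebra_simps)
  then have "2 * M' \<le> a' * (2 * m' + 1 choose m')"
    by (metis add_gr_0 less_numeral_extra(1) mult.left_commute mult_le_cancel1)
  then have "real (2 * M') \<le> real (a' * (2 * m' + 1 choose m'))"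
    by (simp only: of_nat_le_iff)
  then have M'_le: "4 * real M' \<le> real a' * C"
    unfolding D[symmetric] by simp
  have "C * (\<Sum>k\<le>m. hypergeometric a b m k * (2 * real k - real a)\<^sup>2)
      = (\<Sum>k\<le>m. real (w k) * (2 * real k - real a)\<^sup>2)"
    using C0 by (simp add: sum_distrib_left hypergeometric_def w_def flip: C_def)
  also have "\<dots> = (\<Sum>k\<le>m. 4 * real (k * k * w k) - 4 * real a * real (k * w k)
      + (real a)\<^sup>2 * real (w k))"
    by (intro sum.cong refl) (simp add: power2_eq_square algebra_simps)
  also have "\<dots> = 4 * real T - 4 * real a * real M + (real a)\<^sup>2 * C"
    unfolding T_def M_def S[symmetric]
    by (simp add: sum.distrib sum_subtractf sum_distrib_left)
  also have "\<dots> = real a * (4 * real M' + 2 * C - real a * C)"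
  proof -
    have "4 * real a * real M = 2 * real a * (real a * C)"
      unfolding M[symmetric] by simp
    moreover have "4 * real T = real a * (4 * real M' + 2 * C)"
      unfolding D[symmetric] by (simp add: T algebra_simps)
    ultimately show ?thesis by (simp only: power2_eq_square) (simp add: algebra_simps)
  qed
  also have "\<dots> \<le> real a * C"
    using M'_le by (intro mult_left_mono) (simp_all add: a algebra_simps)
  finally show ?thesis using C0 by (simp add: mult.commute)
qed

text \<open>The squared numerator is at most \<open>4^a 4^b = 16^m\<close> divided by
  \<open>a m\<close>, where \<open>a \<le> b\<close> gives \<open>m \<le> b\<close>. The squared
  denominator is at least \<open>16^m / (4 m)\<close>. The factors \<open>m\<close> cancel, which
  leaves \<open>4 / a\<close> for the square.\<close>

lemma hypergeometric_le:
  assumes ab: "a + b = 2 * m" and "0 < a" "a \<le> b"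
  shows "hypergeometric a b m k \<le> 2 / sqrt (real a)"
proof -
  let ?x = "real (a choose k)" and ?y = "real (b choose (m - k))" and ?c = "real (a + b choose m)"
  have m: "0 < m" "m \<le> b" using assms by auto
  have c: "?c > 0" using ab by simp
  have "real m * (real a * (?x * ?y)\<^sup>2) = (real a * ?x\<^sup>2) * (real m * ?y\<^sup>2)"
    by (simp add: power_mult_distrib)
  also have "\<dots> \<le> (real (a + 1) * ?x\<^sup>2) * (real (b + 1) * ?y\<^sup>2)"
    using m by (intro mult_mono mult_right_mono) auto
  also have "\<dots> \<le> 4 ^ a * 4 ^ b"
    by (intro mult_mono binomial_sq_le) auto
  also have "\<dots> = 16 ^ m"
    using ab by (simp add: power_mult flip: power_add)
  also have "\<dots> \<le> 4 * real m * ?c\<^sup>2"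
    using central_binomial_sq_ge[OF m(1)] ab by simp
  finally have "real a * (?x * ?y)\<^sup>2 \<le> 4 * ?c\<^sup>2" using m by simp
  then have "real a * (hypergeometric a b m k)\<^sup>2 \<le> 4"
    using c by (simp add: hypergeometric_def power_divide pos_divide_le_eq)
  then have "(hypergeometric a b m k)\<^sup>2 \<le> (2 / sqrt (real a))\<^sup>2"
    using assms(2) by (simp add: power_divide pos_le_divide_eq mult.commute)
  then show ?thesis by (rule power2_le_imp_le) simp
qed

lemma sum_geometric_le:
  fixes q :: real
  assumes "finite K" "inj_on f K" "0 \<le> q" "q < 1"
  shows "(\<Sum>k\<in>K. q ^ f k) \<le> 1 / (1 - q)"
proof -
  have "(\<Sum>k\<in>K. q ^ f k) = (\<Sum>j\<in>f ` K. q ^ j)"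
    using assms(2) by (simp add: sum.reindex)
  also have "\<dots> \<le> (\<Sum>j. q ^ j)"
    using assms by (intro sum_le_suminf) (auto intro: summable_geometric)
  also have "\<dots> = 1 / (1 - q)"
    using assms by (intro suminf_geometric) simp
  finally show ?thesis .
qed

text \<open>On either side of \<open>2 k = a\<close> the distances to \<open>a\<close> are distinct
  natural numbers, so each half is dominated by a geometric series in \<open>exp (- t)\<close>. The
  bound does not depend on \<open>m\<close> or \<open>a\<close>.\<close>

lemma sum_exp_abs_le:
  assumes "t > 0"
  shows "(\<Sum>k\<le>m. exp (- t * \<bar>2 * real k - real a\<bar>)) \<le> 2 * (1 + 1 / t)"
proof -
  let ?q = "exp (- t)" and ?K = "{k. k \<le> m \<and> a \<le> 2 * k}" and ?L = "{k. k \<le> m \<and> \<not> a \<le> 2 * k}"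
  have "1 + t \<le> exp t" by (rule exp_ge_add_one_self)
  then have "?q \<le> 1 / (1 + t)"
    using assms by (simp add: exp_minus field_simps)
  also have "\<dots> = 1 - t / (1 + t)" using assms by (simp add: field_simps)
  finally have "t / (1 + t) \<le> 1 - ?q" by simp
  then have "1 / (1 - ?q) \<le> 1 / (t / (1 + t))"
    using assms by (intro divide_left_mono) auto
  then have q: "1 / (1 - ?q) \<le> 1 + 1 / t" using assms by (simp add: field_simps)
  have K: "(\<Sum>k\<in>?K. exp (- t * \<bar>2 * real k - real a\<bar>)) = (\<Sum>k\<in>?K. ?q ^ (2 * k - a))"
    by (intro sum.cong) (auto simp flip: exp_of_nat_mult)
  have L: "(\<Sum>k\<in>?L. exp (- t * \<bar>2 * real k - real a\<bar>)) = (\<Sum>k\<in>?L. ?q ^ (a - 2 * k))"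
    by (intro sum.cong) (auto simp: algebra_simps simp flip: exp_of_nat_mult)
  have "(\<Sum>k\<le>m. exp (- t * \<bar>2 * real k - real a\<bar>))
      = (\<Sum>k\<in>?K. exp (- t * \<bar>2 * real k - real a\<bar>)) + (\<Sum>k\<in>?L. exp (- t * \<bar>2 * real k - real a\<bar>))"
    by (subst sum.union_disjoint[symmetric]) (auto intro: sum.cong)
  also have "\<dots> \<le> 1 / (1 - ?q) + 1 / (1 - ?q)"
    unfolding K L using assms by (intro add_mono sum_geometric_le) (auto simp: inj_on_def)
  finally show ?thesis using q by simp
qed

section \<open>Two-sided bounds on the hypergeometric entropy\<close>

definition hypergeometric_entropy :: "nat \<Rightarrow> nat \<Rightarrow> nat \<Rightarrow> real" where
  "hypergeometric_entropy a b r = - (\<Sum>k\<le>r. hypergeometric a b r k * ln (hypergeometric a b r k))"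

text \<open>The reflection \<open>k \<mapsto> r - k\<close> exchanges the two parts. For the Dicke
  state this is the equality of the entropies of a subsystem and its complement.\<close>

lemma hypergeometric_entropy_commute:
  "hypergeometric_entropy a b r = hypergeometric_entropy b a r"
  unfolding hypergeometric_entropy_def neg_equal_iff_equal
  by (rule sum.reindex_bij_witness[of _ "\<lambda>k. r - k" "\<lambda>k. r - k"])
    (auto simp: hypergeometric_def add.commute mult.commute)

lemma hypergeometric_entropy_ge:
  assumes "a + b = 2 * m" "0 < a" "a \<le> b"
  shows "1/2 * ln (real a) - ln 2 \<le> hypergeometric_entropy a b m"
proof -
  have "- ln (2 / sqrt (real a)) \<le> hypergeometric_entropy a b m"
    unfolding hypergeometric_entropy_def
    using assms by (intro entropy_ge_of_bounded hypergeometric_nonneg hypergeometric_le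
      sum_hypergeometric) auto
  then show ?thesis using assms(2) by (simp add: ln_div ln_sqrt)
qed

lemma hypergeometric_entropy_le:
  assumes ab: "a + b = 2 * m" and a: "0 < a"
  shows "hypergeometric_entropy a b m \<le> 1/2 * ln (real a) + ln 4 + 1"
proof -
  \<comment> \<open>The width \<open>sqrt a\<close> of the weights matches the bound on the standard
    deviation of \<open>2 k - a\<close>: the sum of the weights stays of order
    \<open>sqrt a\<close>, while the mean of \<open>- ln (w k)\<close> stays bounded.\<close>
  define t where "t = 1 / sqrt (real a)"
  define w where "w k = exp (- t * \<bar>2 * real k - real a\<bar>)" for k
  let ?p = "hypergeometric a b m"
  have t: "t > 0" "t\<^sup>2 = 1 / real a" using a by (simp_all add: t_def power_divide)
  have p1: "sum ?p {..m} = 1" using ab by (intro sum_hypergeometric) simp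
  have gibbs: "hypergeometric_entropy a b m \<le> ln (sum w {..m}) - (\<Sum>k\<le>m. ?p k * ln (w k))"
    unfolding hypergeometric_entropy_def
    using p1 by (intro entropy_le_cross_entropy) (auto simp: hypergeometric_nonneg w_def)
  have "ln (sum w {..m}) \<le> ln (4 * sqrt (real a))"
  proof (rule ln_mono)
    show "0 < sum w {..m}" by (intro sum_pos) (auto simp: w_def)
    have "sum w {..m} \<le> 2 * (1 + sqrt (real a))"
      using sum_exp_abs_le[OF t(1)] unfolding w_def by (simp add: t_def)
    also have "\<dots> \<le> 4 * sqrt (real a)" using a by simp
    finally show "sum w {..m} \<le> 4 * sqrt (real a)" .
  qed
  also have "\<dots> = ln 4 + 1/2 * ln (real a)"
    using a by (simp add: ln_mult ln_sqrt)
  finally have partition: "ln (sum w {..m}) \<le> ln 4 + 1/2 * ln (real a)" .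
  have "- (\<Sum>k\<le>m. ?p k * ln (w k)) \<le> 1"
  proof -
    \<comment> \<open>The inequality \<open>y \<le> (1 + y^2) / 2\<close> replaces the absolute
      deviation by the second moment.\<close>
    have "- (?p k * ln (w k)) \<le> 1/2 * ?p k + 1/2 * t\<^sup>2 * (?p k * (2 * real k - real a)\<^sup>2)" for k
    proof -
      define y where "y = t * \<bar>2 * real k - real a\<bar>"
      have "0 \<le> (1 - y)\<^sup>2" by simp
      then have "y \<le> 1/2 + 1/2 * y\<^sup>2" by (simp add: power2_eq_square algebra_simps)
      then have "?p k * y \<le> ?p k * (1/2 + 1/2 * y\<^sup>2)"
        by (intro mult_left_mono hypergeometric_nonneg)
      then show ?thesis by (simp add: w_def y_def power_mult_distrib algebra_simps)
    qed
    then have "- (\<Sum>k\<le>m. ?p k * ln (w k))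
        \<le> (\<Sum>k\<le>m. 1/2 * ?p k + 1/2 * t\<^sup>2 * (?p k * (2 * real k - real a)\<^sup>2))"
      unfolding sum_negf[symmetric] by (intro sum_mono)
    also have "\<dots> = 1/2 + 1/2 * t\<^sup>2 * (\<Sum>k\<le>m. ?p k * (2 * real k - real a)\<^sup>2)"
      using p1 by (simp add: sum.distrib flip: sum_distrib_left sum_divide_distrib)
    also have "\<dots> \<le> 1/2 + 1/2 * t\<^sup>2 * real a"
      using hypergeometric_second_moment_le[OF ab a] by (intro add_left_mono mult_left_mono) auto
    also have "\<dots> = 1" using t a by simp
    finally show ?thesis .
  qed
  then show ?thesis using gibbs partition by linarith
qed

text \<open>By symmetry the smaller part may play the role of \<open>a\<close>. The constant comes
  from the upper bound and exceeds the \<open>ln 2\<close> of the lower one.\<close>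

lemma hypergeometric_entropy_min:
  assumes ab: "a + b = 2 * m" and "0 < a" "0 < b"
  shows "\<bar>hypergeometric_entropy a b m - 1/2 * ln (real (min a b))\<bar> \<le> ln 4 + 1"
proof -
  have *: "\<bar>hypergeometric_entropy a b m - 1/2 * ln (real a)\<bar> \<le> ln 4 + 1"
    if "a + b = 2 * m" "0 < a" "a \<le> b" for a b
  proof -
    have "ln 2 \<le> ln (4::real)" by simp
    then show ?thesis
      using hypergeometric_entropy_ge[OF that] hypergeometric_entropy_le[OF that(1,2)]
      by (simp only: abs_le_iff) linarith
  qed
  show ?thesis
    using *[of a b] *[of b a] assms hypergeometric_entropy_commute[of a b m]
    by (cases "a \<le> b") (auto simp: min_def add.commute)
qed

subsection \<open>The Dicke state\<close>

definition count_up :: "nat set \<Rightarrow> (nat \<Rightarrow> int) \<Rightarrow> nat" where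
  "count_up V s = card {i \<in> V. s i = 1}"

lemma finite_spins: "finite V \<Longrightarrow> finite (spins V)"
  by (simp add: spins_def finite_PiE)

lemma card_spins_count_up:
  assumes "finite V"
  shows "card {s \<in> spins V. count_up V s = k} = card V choose k"
proof -
  have "bij_betw (\<lambda>s. {i \<in> V. s i = 1}) {s \<in> spins V. count_up V s = k} {B. B \<subseteq> V \<and> card B = k}"
  proof (rule bij_betw_byWitness[where f' = "\<lambda>B. \<lambda>i\<in>V. if i \<in> B then 1 else -1"])
    show "\<forall>s\<in>{s \<in> spins V. count_up V s = k}.
        (\<lambda>i\<in>V. if i \<in> {i \<in> V. s i = 1} then 1 else -1) = s"
      by (auto simp: spins_def PiE_iff extensional_def fun_eq_iff)
    show "(\<lambda>B. \<lambda>i\<in>V. if i \<in> B then 1 else -1) ` {B. B \<subseteq> V \<and> card B = k}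
        \<subseteq> {s \<in> spins V. count_up V s = k}"
    proof clarify
      fix B assume "B \<subseteq> V" "k = card B"
      moreover from this have "{i \<in> V. (\<lambda>i\<in>V. if i \<in> B then 1 else (-1::int)) i = 1} = B"
        by auto
      ultimately show "(\<lambda>i\<in>V. if i \<in> B then 1 else -1) \<in> spins V \<and>
          count_up V (\<lambda>i\<in>V. if i \<in> B then 1 else -1) = card B"
        by (auto simp: spins_def count_up_def)
    qed
  qed (auto simp: count_up_def)
  then show ?thesis using assms by (simp add: bij_betw_same_card n_subsets)
qed

lemma sum_spins:
  assumes "finite V" "s \<in> spins V"
  shows "(\<Sum>i\<in>V. s i) = 2 * int (count_up V s) - int (card V)"
proof -
  have "(\<Sum>i\<in>V. s i) = (\<Sum>i\<in>V. 2 * of_bool (s i = 1) - 1)"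
    using assms(2) by (intro sum.cong) (auto simp: spins_def PiE_iff)
  also have "\<dots> = 2 * int (count_up V s) - int (card V)"
    using assms(1) by (simp add: sum_subtractf count_up_def Int_def flip: sum_distrib_left)
  finally show ?thesis .
qed

lemma override_on_spins:
  assumes "A \<subseteq> V" "s \<in> spins A" "t \<in> spins (V - A)"
  shows "override_on t s A \<in> spins V"
  using assms by (auto simp: spins_def PiE_iff extensional_def override_on_def)

lemma count_up_override_on:
  assumes "finite V" "A \<subseteq> V"
  shows "count_up V (override_on t s A) = count_up A s + count_up (V - A) t"
proof -
  have "{i \<in> V. override_on t s A i = 1} = {i \<in> A. s i = 1} \<union> {i \<in> V - A. t i = 1}"
    using assms(2) by (auto simp: override_on_def)
  moreover have "finite A" using assms by (rule rev_finite_subset)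
  ultimately show ?thesis
    using assms(1) unfolding count_up_def by (simp, intro card_Un_disjoint) auto
qed

text \<open>The argument of \<open>\<sigma>\<close> is the integer
  \<open>2 * count_up - 2 * m\<close>, so the values of \<open>\<sigma>\<close> on the integers
  determine the amplitude.\<close>

lemma perceptron_amplitude_Dicke:
  assumes "kronecker_on_ints \<sigma>" "s \<in> spins {1..2 * m}"
  shows "perceptron_amplitude (2 * m) (\<lambda>_. 1) 0 \<sigma> s = of_bool (count_up {1..2 * m} s = m)"
proof -
  have "perceptron_amplitude (2 * m) (\<lambda>_. 1) 0 \<sigma> s = \<sigma> (real_of_int (\<Sum>i\<in>{1..2 * m}. s i))"
    by (simp add: perceptron_amplitude_def)
  also have "\<dots> = (if (\<Sum>i\<in>{1..2 * m}. s i) = 0 then 1 else 0)"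
    using assms(1) unfolding kronecker_on_ints_def by blast
  also have "(\<Sum>i\<in>{1..2 * m}. s i) = 0 \<longleftrightarrow> count_up {1..2 * m} s = m"
    using sum_spins[OF _ assms(2)] by simp
  finally show ?thesis by (simp only: of_bool_def)
qed

lemma perceptron_state_Dicke:
  assumes \<sigma>: "kronecker_on_ints \<sigma>" and s: "s \<in> spins {1..2 * m}"
  shows "perceptron_state (2 * m) (\<lambda>_. 1) 0 \<sigma> s
    = of_bool (count_up {1..2 * m} s = m) / complex_of_real (sqrt (real (2 * m choose m)))"
proof -
  have "(\<Sum>s\<in>spins {1..2 * m}. (cmod (perceptron_amplitude (2 * m) (\<lambda>_. 1) 0 \<sigma> s))\<^sup>2)
      = (\<Sum>s\<in>spins {1..2 * m}. of_bool (count_up {1..2 * m} s = m))"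
    by (intro sum.cong refl) (simp add: perceptron_amplitude_Dicke[OF \<sigma>])
  also have "\<dots> = real (2 * m choose m)"
    using card_spins_count_up[of "{1..2 * m}" m] by (simp add: finite_spins Int_def)
  finally show ?thesis
    by (simp add: perceptron_state_def perceptron_amplitude_Dicke[OF \<sigma> s])
qed

text \<open>A configuration \<open>t\<close> of the complement contributes only if it completes both
  \<open>s\<close> and \<open>s'\<close> to \<open>m\<close> up spins. This forces equal counts on
  \<open>A\<close>, and the entry then counts the \<open>t\<close> with
  \<open>m - count_up A s\<close> up spins. The guard \<open>count_up A s \<le> m\<close> excludes
  the case where this difference is truncated.\<close>

lemma partial_trace_Dicke:
  assumes \<sigma>: "kronecker_on_ints \<sigma>" and A: "A \<subseteq> {1..2 * m}"
    and s: "s \<in> spins A" "s' \<in> spins A"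
  shows "partial_trace {1..2 * m} A (pure_density (perceptron_state (2 * m) (\<lambda>_. 1) 0 \<sigma>)) s s'
    = (if count_up A s = count_up A s'
       then complex_of_real (of_bool (count_up A s \<le> m) *
         real (2 * m - card A choose (m - count_up A s)) / real (2 * m choose m)) else 0)"
proof -
  let ?V = "{1..2 * m}"
  let ?k = "count_up A s" and ?k' = "count_up A s'" and ?C = "real (2 * m choose m)"
  have fin: "finite (?V - A)" by simp
  have card: "card (?V - A) = 2 * m - card A"
    using A by (subst card_Diff_subset) (auto intro: finite_subset)
  have C: "complex_of_real (sqrt ?C) * complex_of_real (sqrt ?C) = complex_of_real ?C"
    by (simp flip: of_real_mult)
  have "partial_trace ?V A (pure_density (perceptron_state (2 * m) (\<lambda>_. 1) 0 \<sigma>)) s s'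
      = (\<Sum>t\<in>spins (?V - A). of_bool (?k = ?k') * of_bool (?k + count_up (?V - A) t = m)
          / complex_of_real ?C)"
    unfolding partial_trace_def pure_density_def
    by (intro sum.cong refl)
      (auto simp: perceptron_state_Dicke[OF \<sigma> override_on_spins[OF A]] s C
        count_up_override_on[OF finite_atLeastAtMost A] simp del: One_nat_def)
  also have "\<dots> = of_bool (?k = ?k') *
      of_nat (card {t \<in> spins (?V - A). ?k + count_up (?V - A) t = m}) / complex_of_real ?C"
    by (simp add: finite_spins Int_def flip: sum_distrib_left sum_divide_distrib)
  also have "card {t \<in> spins (?V - A). ?k + count_up (?V - A) t = m}
      = of_bool (?k \<le> m) * (2 * m - card A choose (m - ?k))"
  proof (cases "?k \<le> m")
    case True
    then have "{t \<in> spins (?V - A). ?k + count_up (?V - A) t = m}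
        = {t \<in> spins (?V - A). count_up (?V - A) t = m - ?k}" by auto
    then show ?thesis using card_spins_count_up[OF fin] True by (simp add: card del: One_nat_def)
  next
    case False
    then show ?thesis by simp
  qed
  finally show ?thesis by simp
qed

lemma entanglement_entropy_Dicke:
  assumes \<sigma>: "kronecker_on_ints \<sigma>" and A: "A \<subseteq> {1..2 * m}"
  shows "entanglement_entropy (2 * m) (perceptron_state (2 * m) (\<lambda>_. 1) 0 \<sigma>) A
    = hypergeometric_entropy (card A) (2 * m - card A) m"
proof -
  let ?a = "card A"
  define g where
    "g k = of_bool (k \<le> m) * real (2 * m - ?a choose (m - k)) / real (2 * m choose m)" for k
  define p where "p k = real (card {s \<in> spins A. count_up A s = k}) * g k" for k
  have finA: "finite A" using A by (rule finite_subset) simp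
  have a: "?a \<le> 2 * m" using card_mono[OF _ A] by simp
  have p: "p k = of_bool (k \<le> m) * hypergeometric ?a (2 * m - ?a) m k" for k
    using a by (simp add: p_def g_def hypergeometric_def card_spins_count_up[OF finA])
  have "entanglement_entropy (2 * m) (perceptron_state (2 * m) (\<lambda>_. 1) 0 \<sigma>) A
      = - (\<Sum>k\<in>count_up A ` spins A. p k * ln (p k))"
    unfolding entanglement_entropy_def p_def
    using finA partial_trace_Dicke[OF \<sigma> A]
    by (intro von_neumann_entropy_block_constant) (simp_all add: finite_spins g_def)
  \<comment> \<open>Neither index set need contain the other. Counts above \<open>m\<close> have
    \<open>p k = 0\<close> by the guard, values of \<open>k\<close> not attained on \<open>A\<close>
    have an empty level set, and \<open>0 * ln 0 = 0\<close>.\<close>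
  also have "(\<Sum>k\<in>count_up A ` spins A. p k * ln (p k)) = (\<Sum>k\<le>m. p k * ln (p k))"
  proof (rule sum.mono_neutral_cong)
    fix k assume "k \<in> {..m} - count_up A ` spins A"
    then have "{s \<in> spins A. count_up A s = k} = {}" by auto
    then have "p k = 0" by (simp only: p_def card.empty of_nat_0 mult_zero_left)
    then show "p k * ln (p k) = 0" by simp
  qed (auto simp: p finite_spins[OF finA])
  also have "\<dots> = - hypergeometric_entropy ?a (2 * m - ?a) m"
    by (simp add: p hypergeometric_entropy_def)
  finally show ?thesis by simp
qed

lemma entanglement_entropy_Dicke_min:
  assumes \<sigma>: "kronecker_on_ints \<sigma>" and "even n" and A: "A \<subset> {1..n}" "A \<noteq> {}"
  shows "\<bar>entanglement_entropy n (perceptron_state n (\<lambda>_. 1) 0 \<sigma>) A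
    - 1/2 * ln (real (min (card A) (card ({1..n} - A))))\<bar> \<le> ln 4 + 1"
proof -
  obtain m where n: "n = 2 * m" using \<open>even n\<close> by blast
  have finA: "finite A" using A by (auto intro: finite_subset)
  have "card ({1..n} - A) = n - card A"
    using A finA by (subst card_Diff_subset) auto
  moreover have "card A < n" using psubset_card_mono[OF _ A(1)] by simp
  moreover have "0 < card A" using A finA by (simp add: card_gt_0_iff)
  ultimately show ?thesis
    using hypergeometric_entropy_min[of "card A" "n - card A" m]
      entanglement_entropy_Dicke[OF \<sigma>, of A m] A
    by (simp add: n)
qed

text \<open>For \<open>A = {1..n}\<close> the entropy is 0 while \<open>ln (card A)\<close> is
  unbounded, so the \<open>O(1)\<close> claim needs room in the complement. It is stated with
  \<open>card A\<close> at most a fixed fraction \<open>1 - \<delta>\<close> of \<open>n\<close>,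
  and for all proper nonempty subsets with the size of the smaller part. The other two claims follow
  from this last one.\<close>

theorem theorem1:
  fixes \<sigma> :: "real \<Rightarrow> complex" and \<Psi> :: "nat \<Rightarrow> state"
  assumes "kronecker_on_ints \<sigma>"
  defines "\<Psi> \<equiv> (\<lambda>n. perceptron_state n (\<lambda>_. 1) 0 \<sigma>)"
  shows "log_entanglement_scaling {n. even n} \<Psi> \<and>
    (\<forall>\<delta>>0. \<exists>C. \<forall>n. even n \<longrightarrow> (\<forall>A\<subseteq>{1..n}.
       A \<noteq> {} \<and> real (card A) \<le> (1 - \<delta>) * real n \<longrightarrow>
       \<bar>entanglement_entropy n (\<Psi> n) A - 1/2 * ln (real (card A))\<bar> \<le> C)) \<and>
    (\<exists>C. \<forall>n. even n \<longrightarrow> (\<forall>A\<subset>{1..n}. A \<noteq> {} \<longrightarrow>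
       \<bar>entanglement_entropy n (\<Psi> n) A
          - 1/2 * ln (real (min (card A) (card ({1..n} - A))))\<bar> \<le> C))"
proof (intro conjI)
  define L :: real where "L = ln 4 + 1"
  have main: "\<bar>entanglement_entropy n (\<Psi> n) A
      - 1/2 * ln (real (min (card A) (card ({1..n} - A))))\<bar> \<le> L"
    if "even n" "A \<subset> {1..n}" "A \<noteq> {}" for n A
    unfolding \<Psi>_def L_def using assms(1) that by (rule entanglement_entropy_Dicke_min)
  have card_compl: "card ({1..n} - A) = n - card A" if "A \<subseteq> {1..n}" for n A
    using that by (subst card_Diff_subset) (auto intro: finite_subset)
  show "\<exists>C. \<forall>n. even n \<longrightarrow> (\<forall>A\<subset>{1..n}. A \<noteq> {} \<longrightarrow>
       \<bar>entanglement_entropy n (\<Psi> n) A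
          - 1/2 * ln (real (min (card A) (card ({1..n} - A))))\<bar> \<le> C)"
    using main by blast
  show "log_entanglement_scaling {n. even n} \<Psi>"
    unfolding log_entanglement_scaling_def
  \<comment> \<open>The witnesses are fixed by unification below. The threshold
    \<open>exp (4 * L)\<close> makes \<open>L\<close> at most a quarter of
    \<open>ln (card A)\<close>, so that the constants become \<open>1/2 - 1/4\<close> and
    \<open>1/2 + 1/4\<close>.\<close>
  proof (intro exI conjI ballI allI impI)
    fix n A
    assume n: "n \<in> {n::nat. even n}" and A: "A \<subseteq> {1..n}"
      and card: "nat \<lceil>exp (4 * L)\<rceil> \<le> card A \<and> 2 * card A \<le> n"
    have "exp (4 * L) \<le> real (card A)" using card by linarith
    moreover from this have pos: "0 < real (card A)" by (rule less_le_trans[OF exp_gt_zero])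
    ultimately have L: "4 * L \<le> ln (real (card A))" by (simp add: ln_ge_iff)
    have "A \<noteq> {1..n}" "A \<noteq> {}" using card pos by auto
    moreover have "min (card A) (card ({1..n} - A)) = card A"
      using card card_compl[OF A] by (intro min_absorb1) linarith
    ultimately have "\<bar>entanglement_entropy n (\<Psi> n) A - 1/2 * ln (real (card A))\<bar> \<le> L"
      using main[of n A] n A by auto
    then have E: "1/2 * ln (real (card A)) - L \<le> entanglement_entropy n (\<Psi> n) A"
      "entanglement_entropy n (\<Psi> n) A \<le> 1/2 * ln (real (card A)) + L"
      by linarith+
    show "1/4 * ln (real (card A)) \<le> entanglement_entropy n (\<Psi> n) A"
      using E L by linarith
    show "entanglement_entropy n (\<Psi> n) A \<le> 3/4 * ln (real (card A))"
      using E L by linarith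
  qed simp_all
  show "\<forall>\<delta>>0. \<exists>C. \<forall>n. even n \<longrightarrow> (\<forall>A\<subseteq>{1..n}.
       A \<noteq> {} \<and> real (card A) \<le> (1 - \<delta>) * real n \<longrightarrow>
       \<bar>entanglement_entropy n (\<Psi> n) A - 1/2 * ln (real (card A))\<bar> \<le> C)"
  proof (intro allI impI)
    fix \<delta> :: real assume \<delta>: "\<delta> > 0"
    show "\<exists>C. \<forall>n. even n \<longrightarrow> (\<forall>A\<subseteq>{1..n}.
       A \<noteq> {} \<and> real (card A) \<le> (1 - \<delta>) * real n \<longrightarrow>
       \<bar>entanglement_entropy n (\<Psi> n) A - 1/2 * ln (real (card A))\<bar> \<le> C)"
    proof (intro exI allI impI)
      fix n A
      assume n: "even n" and A: "A \<subseteq> {1..n}"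
        and card: "A \<noteq> {} \<and> real (card A) \<le> (1 - \<delta>) * real n"
      define b where "b = min (card A) (card ({1..n} - A))"
      have a0: "0 < card A"
        using A card by (auto simp: card_gt_0_iff intro: finite_subset)
      have a: "card A \<le> n" using card_mono[OF _ A] by simp
      have n0: "0 < n" using a0 a by simp
      have "\<delta> * real n \<le> real (card ({1..n} - A))"
        using card card_compl[OF A] a by (simp add: of_nat_diff algebra_simps)
      moreover have "\<delta> * real (card A) \<le> \<delta> * real n" "0 < \<delta> * real n"
        using a \<delta> n0 by simp_all
      ultimately have compl: "\<delta> * real (card A) \<le> real (card ({1..n} - A))"
        "0 < card ({1..n} - A)" by linarith+
      \<comment> \<open>Capping \<open>\<delta>\<close> at 1 makes
        \<open>min 1 \<delta> * card A\<close> a lower bound for both parts, hence for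
        \<open>b\<close>. Replacing \<open>b\<close> by \<open>card A\<close> then costs at most
        \<open>- 1/2 * ln (min 1 \<delta>)\<close>.\<close>
      have "min 1 \<delta> * real (card A) \<le> 1 * real (card A)"
        "min 1 \<delta> * real (card A) \<le> \<delta> * real (card A)"
        by (intro mult_right_mono; simp)+
      then have "min 1 \<delta> * real (card A) \<le> real (card A)"
        "min 1 \<delta> * real (card A) \<le> real (card ({1..n} - A))"
        using compl(1) by linarith+
      moreover have "b = card A \<or> b = card ({1..n} - A)"
        unfolding b_def min_def by presburger
      ultimately have b: "0 < b" "min 1 \<delta> * real (card A) \<le> real b"
        using a0 compl(2) by metis+
      have "b \<le> card A" by (simp add: b_def)
      have "ln (min 1 \<delta>) + ln (real (card A)) = ln (min 1 \<delta> * real (card A))"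
        using \<delta> a0 by (simp add: ln_mult)
      also have "\<dots> \<le> ln (real b)"
        by (rule ln_mono[OF b(2)]) (use \<delta> a0 in simp)
      finally have low: "ln (min 1 \<delta>) + ln (real (card A)) \<le> ln (real b)" .
      have up: "ln (real b) \<le> ln (real (card A))"
        using b(1) \<open>b \<le> card A\<close> by (intro ln_mono) auto
      have "A \<subset> {1..n}" using A compl(2) by auto
      then have "\<bar>entanglement_entropy n (\<Psi> n) A - 1/2 * ln (real b)\<bar> \<le> L"
        unfolding b_def using main[OF n] card by blast
      then show "\<bar>entanglement_entropy n (\<Psi> n) A - 1/2 * ln (real (card A))\<bar>
          \<le> L - 1/2 * ln (min 1 \<delta>)"
        using low up by linarith
    qed
  qed
qed

end
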